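(* Let $k\ge1$, $d\ge1$, $t\ge 0$ and $R=2^t$. Then $$B_t(k,d)=\begin{cases}\rho_k(d/R-1),& R\mid d,\\ 0,& R\nmid d.\end{cases}$$ In particular, $$\max_{t\ge0,\ 2^t\le d}B_t(k,d)=\rho_k(d-1)\le\lambda_{\rm lex}(M(k,d)).$$
   Context: $\mathbb N$ includes $0$. $\mathcal P_k=\mathbb F_2[x_1,\dots,x_k]$ with $\deg x_i=1$; $\mathcal P_k^n$ is the degree-$n$ part. For $e\in\mathbb N^k$, $x^e=\prod x_i^{e_i}$, $|e|=\sum e_i$. Steenrod squares act linearly by $\mathrm{Sq}^r(x^a)=\sum_{b\in\mathbb N^k,|b|=r}\prod_i\binom{a_i}{b_i}x^{a+b}$ (mod 2). $\rho_k(n)=\operatorname{rank}(\mathrm{Sq}^1:\mathcal P_k^n\to\mathcal P_k^{n+1})$. For $1\le q\le k$: if $N:=(d-(q+1)R)/(2R)$ is a nonnegative integer, put $$B_{t,q}(k,d)=\sum_{s=q}^{\min(k,N+q)}\binom{s-1}{q-1}\binom ks\binom{N+q-1}{s-1},$$ and otherwise $B_{t,q}(k,d)=0$. Equivalently, when $N$ is a nonnegative integer, $B_{t,q}(k,d)$ is the dimension of the span of the polynomials $\mathrm{Sq}^R(g)$ over all monomials $g=\prod_{j\in J}x_j^{2Ra_j+R}\prod_{j\notin J}x_j^{2Ra_j}$ with $|J|=q$ and $\sum_ja_j=N$. Put $B_t(k,d)=\sum_{q=1}^kB_{t,q}(k,d)$. The hit matrix $M(k,d)$ is the matrix, in monomial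 bases, of $\bigoplus_{t\ge0,\,2^t\le d}\mathcal P_k^{d-2^t}\to\mathcal P_k^d$, $(g_t)_t\mapsto\sum_t\mathrm{Sq}^{2^t}(g_t)$. $\lambda_{\rm lex}(M(k,d))$ is the number of distinct monomials that occur as the largest monomial, in exponent lexicographic order, of a nonzero column; in this order on monomials of degree $d$ one compares the first (smallest-index) differing exponent, the larger exponent giving the larger monomial. *)

theory Defs
  imports Complex_Main "HOL-Library.Poly_Mapping" "HOL-Library.Z2"
begin

text \<open>
  An exponent vector in \<open>\<nat>\<^sup>k\<close> is a finitely supported function whose support lies in
  \<open>{1..k}\<close>, and \<open>\<P>\<^sub>k\<close> consists of the elements of type \<open>poly2\<close> all of whose exponent vectors are
  of this kind.  The library order on \<open>expo\<close> is the exponent lexicographic order: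
  the smallest differing index decides, the larger exponent there giving the larger vector.
\<close>

type_synonym expo = "nat \<Rightarrow>\<^sub>0 nat"
type_synonym poly2 = "expo \<Rightarrow>\<^sub>0 bit"

abbreviation monomial :: "expo \<Rightarrow> poly2" where
  "monomial a \<equiv> Poly_Mapping.single a 1"

definition expos :: "nat \<Rightarrow> nat \<Rightarrow> expo set" where
  "expos k n = {e. Poly_Mapping.keys e \<subseteq> {1..k} \<and> (\<Sum>i=1..k. Poly_Mapping.lookup e i) = n}"

definition homog :: "nat \<Rightarrow> nat \<Rightarrow> poly2 set" where
  "homog k n = {p. Poly_Mapping.keys p \<subseteq> expos k n}"

definition scale2 :: "bit \<Rightarrow> poly2 \<Rightarrow> poly2" where
  "scale2 c p = Poly_Mapping.single 0 c * p"

global_interpretation poly2: vector_space scale2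
proof
  fix a b :: bit and x y :: poly2
  show "scale2 a (x + y) = scale2 a x + scale2 a y" by (simp only: scale2_def distrib_left)
  show "scale2 (a + b) x = scale2 a x + scale2 b x" by (simp only: scale2_def single_add distrib_right)
  show "scale2 a (scale2 b x) = scale2 (a * b) x"
    by (simp only: scale2_def mult.assoc[symmetric] mult_single add_0_left)
  show "scale2 1 x = x" by (simp only: scale2_def single_one mult_1_left)
qed

lemma finite_expos: "finite (expos k n)"
proof -
  let ?F = "{f. \<forall>i. (i \<in> {1..k} \<longrightarrow> f i \<in> {..n}) \<and> (i \<notin> {1..k} \<longrightarrow> f i = (0::nat))}"
  have "Poly_Mapping.lookup ` expos k n \<subseteq> ?F"
  proof
    fix f assume "f \<in> Poly_Mapping.lookup ` expos k n"
    then obtain e where f: "f = Poly_Mapping.lookup e"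
      and sub: "Poly_Mapping.keys e \<subseteq> {1..k}"
      and n: "(\<Sum>i=1..k. Poly_Mapping.lookup e i) = n"
      unfolding expos_def by blast
    have "f i \<le> n" if "i \<in> {1..k}" for i
      unfolding f n[symmetric] by (rule member_le_sum) (use that in simp_all)
    moreover have "f i = 0" if "i \<notin> {1..k}" for i
      using sub that unfolding f by (meson in_keys_iff subsetD)
    ultimately show "f \<in> ?F" by blast
  qed
  moreover have "finite ?F"
    by (intro finite_set_of_finite_funs) simp_all
  ultimately have "finite (Poly_Mapping.lookup ` expos k n)"
    by (rule finite_subset)
  moreover have "inj_on Poly_Mapping.lookup (expos k n)"
    by (rule inj_onI) (metis poly_mapping_eqI)
  ultimately show ?thesis
    by (rule finite_imageD)
qed

definition Sq_mon :: "nat \<Rightarrow> nat \<Rightarrow> expo \<Rightarrow> poly2" where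
  "Sq_mon k r a =
    (\<Sum>b\<in>expos k r.
      scale2 (of_nat (\<Prod>i=1..k. Poly_Mapping.lookup a i choose Poly_Mapping.lookup b i))
        (monomial (a + b)))"

definition Sq :: "nat \<Rightarrow> nat \<Rightarrow> poly2 \<Rightarrow> poly2" where
  "Sq k r p = (\<Sum>a\<in>Poly_Mapping.keys p. scale2 (Poly_Mapping.lookup p a) (Sq_mon k r a))"

definition rho :: "nat \<Rightarrow> nat \<Rightarrow> nat" where
  "rho k n = poly2.dim (Sq k 1 ` homog k n)"

definition B_N :: "nat \<Rightarrow> nat \<Rightarrow> nat \<Rightarrow> rat" where
  "B_N t q d = (of_nat d - (of_nat q + 1) * 2 ^ t) / (2 * 2 ^ t)"

text \<open>Natural subtraction is harmless below, since \<open>1 \<le> q \<le> s\<close> in all uses.\<close>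

definition Btq :: "nat \<Rightarrow> nat \<Rightarrow> nat \<Rightarrow> nat \<Rightarrow> nat" where
  "Btq t q k d =
    (if B_N t q d \<in> \<nat> then
       let N = nat \<lfloor>B_N t q d\<rfloor> in
       \<Sum>s=q..min k (N + q). ((s - 1) choose (q - 1)) * (k choose s) * ((N + q - 1) choose (s - 1))
     else 0)"

definition Bt :: "nat \<Rightarrow> nat \<Rightarrow> nat \<Rightarrow> nat" where
  "Bt t k d = (\<Sum>q=1..k. Btq t q k d)"

text \<open>
  An element of \<open>\<Oplus>\<^sub>t \<P>\<^sub>k\<^bsup>d-2^t\<^esup>\<close>, with \<open>2 ^ t \<le> d\<close>, is a family of polynomials; its monomial basis is
  indexed by the pairs \<open>(t, a)\<close> in \<open>hit_cols k d\<close>.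
\<close>

definition hit_map :: "nat \<Rightarrow> nat \<Rightarrow> (nat \<Rightarrow> poly2) \<Rightarrow> poly2" where
  "hit_map k d g = (\<Sum>t\<in>{t. 2 ^ t \<le> d}. Sq k (2 ^ t) (g t))"

definition hit_cols :: "nat \<Rightarrow> nat \<Rightarrow> (nat \<times> expo) set" where
  "hit_cols k d = {(t, a). 2 ^ t \<le> d \<and> a \<in> expos k (d - 2 ^ t)}"

definition hit_basis :: "nat \<times> expo \<Rightarrow> nat \<Rightarrow> poly2" where
  "hit_basis = (\<lambda>(t, a) u. if u = t then monomial a else 0)"

definition hit_matrix :: "nat \<Rightarrow> nat \<Rightarrow> expo \<Rightarrow> nat \<times> expo \<Rightarrow> bit" where
  "hit_matrix k d e c = Poly_Mapping.lookup (hit_map k d (hit_basis c)) e"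

definition lambda_lex :: "'r::linorder set \<Rightarrow> 'c set \<Rightarrow> ('r \<Rightarrow> 'c \<Rightarrow> bit) \<Rightarrow> nat" where
  "lambda_lex rows cols M =
    card {Max {e \<in> rows. M e c \<noteq> 0} | c. c \<in> cols \<and> (\<exists>e\<in>rows. M e c \<noteq> 0)}"

definition lambda_lex_hit :: "nat \<Rightarrow> nat \<Rightarrow> nat" where
  "lambda_lex_hit k d = lambda_lex (expos k d) (hit_cols k d) (hit_matrix k d)"

end

theory Submission
  imports Defs
begin

text \<open>
  Call an exponent vector \<open>e \<noteq> 0\<close> a pivot if the first variable occurring in \<open>x\<^sup>e\<close> has an odd exponent
  there.  All the numbers in the theorem count or bound pivots.

  Modulo 2, \<open>Sq\<^sup>1(x\<^sup>e)\<close> is the sum of the monomials \<open>x\<^sub>i x\<^sup>e\<close> over the indices \<open>i\<close> with \<open>e\<^sub>i\<close> odd, and the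
  largest of them belongs to the smallest such \<open>i\<close>.  For a pivot this \<open>i\<close> is the first variable
  \<open>m\<close> of \<open>x\<^sup>e\<close>.  Multiplication by \<open>x\<^sub>m\<close> does not change the first variable, so different pivots
  have different leading monomials \<open>x\<^sub>m x\<^sup>e\<close>.  Hence the images of the pivots
  under \<open>Sq\<^sup>1\<close> are linearly independent, and since
  \<open>Sq\<^sup>1\<close> is the component \<open>t = 0\<close> of the hit matrix, there are at least as many leading monomials
  as pivots (\<open>card_pivots_le_lambda_lex_hit\<close>).  The pivots also suffice to span the image: if
  \<open>x\<^sup>e = x\<^sub>m x\<^sup>b\<close> with \<open>e\<^sub>m\<close> even, then \<open>Sq\<^sup>1(x\<^sup>b)\<close> is \<open>x\<^sup>e\<close> plus pivots, and \<open>Sq\<^sup>1 Sq\<^sup>1 = 0\<close> turns this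
  into an expression of \<open>Sq\<^sup>1(x\<^sup>e)\<close> by images of pivots.  So \<open>\<rho>\<^sub>k(n)\<close> is the number of pivots of
  degree \<open>n\<close> (\<open>rho_eq_card_pivots\<close>).

  The formula for \<open>B\<^bsub>t,q\<^esub>\<close> counts the pivots of degree \<open>d/R - 1\<close> with exactly \<open>q\<close> odd exponents
  (\<open>Btq_eq_card\<close>).  Indeed \<open>e = 2c - 1\<^sub>J\<close>, with \<open>J\<close> the set of odd positions, is determined by its
  support \<open>S\<close> of size \<open>s\<close> (the factor \<open>k choose s\<close>), by \<open>J \<subseteq> S\<close> containing the minimum of \<open>S\<close>
  (\<open>s - 1 choose q - 1\<close>), and by the composition \<open>c\<close> of \<open>N + q\<close> into \<open>s\<close> positive parts
  (\<open>N + q - 1 choose s - 1\<close>).  Summing over \<open>q\<close> gives \<open>B\<^sub>t\<close>.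

  It remains to compare \<open>\<rho>\<^sub>k(d/R - 1)\<close> with \<open>\<rho>\<^sub>k(d - 1)\<close>.  The function \<open>\<rho>\<^sub>k\<close> is not monotone (for \<open>k = 1\<close> it
  is the parity of \<open>n\<close>), but it does not decrease when 2 is added to \<open>n\<close>, nor from an even \<open>n\<close> to
  \<open>n + 1\<close>.  This is enough, because \<open>d - 1\<close> is odd as soon as an \<open>R > 1\<close> divides \<open>d\<close>
  (\<open>card_pivots_le_odd\<close>).
\<close>

section \<open>The operation \<open>Sq\<^sup>1\<close> on monomials\<close>

\<comment> \<open>Keeps the numeral 1 in \<open>bump\<close> and in \<open>Sq k 1\<close>, so that rewrite rules about them apply.\<close>
declare One_nat_def [simp del]

definition odds :: "expo \<Rightarrow> nat set" where
  "odds a = {i. odd (Poly_Mapping.lookup a i)}"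

abbreviation bump :: "expo \<Rightarrow> nat \<Rightarrow> expo" where
  "bump a i \<equiv> a + Poly_Mapping.single i 1"

lemma odds_subset_keys: "odds a \<subseteq> Poly_Mapping.keys a"
  by (auto simp: odds_def in_keys_iff intro!: Nat.gr0I)

lemma finite_odds: "finite (odds a)"
  by (rule finite_subset[OF odds_subset_keys]) simp

lemma lookup_bump:
  "Poly_Mapping.lookup (bump a i) j = Poly_Mapping.lookup a j + (if i = j then 1 else 0)"
  by (simp add: lookup_add lookup_single when_def)

lemma odds_bump: "i \<in> odds a \<Longrightarrow> odds (bump a i) = odds a - {i}"
  by (auto simp: odds_def lookup_bump)

lemma keys_bump: "Poly_Mapping.keys (bump a i) = insert i (Poly_Mapping.keys a)"
  by (auto simp: in_keys_iff lookup_bump split: if_splits)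

lemma inj_bump_index: "bump a i = bump a j \<longleftrightarrow> i = j"
proof
  assume "bump a i = bump a j"
  then have "Poly_Mapping.single i (1::nat) = Poly_Mapping.single j 1" by simp
  then have "Poly_Mapping.lookup (Poly_Mapping.single i (1::nat)) i
      = Poly_Mapping.lookup (Poly_Mapping.single j 1) i" by simp
  then show "i = j" by (simp add: lookup_single when_def split: if_splits)
qed simp

text \<open>
  A smaller index means a larger monomial, which is what makes the first odd index carry the
  leading term of \<open>Sq\<^sup>1\<close> on a monomial.
\<close>

lemma bump_mono: "i \<le> j \<Longrightarrow> bump a j \<le> bump a i"
proof (cases "i = j")
  case False
  assume "i \<le> j"
  with False have "i < j" by simp
  then have "bump a j < bump a i"
    by (auto simp: less_poly_mapping.rep_eq less_fun_def lookup_add lookup_single when_def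
        intro!: exI[of _ i])
  then show ?thesis by simp
qed simp

lemma expos_sum_keys:
  fixes e :: expo
  assumes "Poly_Mapping.keys e \<subseteq> {1..k}"
  shows "(\<Sum>i=1..k. Poly_Mapping.lookup e i) = (\<Sum>i\<in>Poly_Mapping.keys e. Poly_Mapping.lookup e i)"
  by (rule sum.mono_neutral_right[OF finite_atLeastAtMost assms]) (simp add: in_keys_iff)

lemma bump_in_expos:
  assumes "i \<in> {1..k}"
  shows "bump a i \<in> expos k (Suc n) \<longleftrightarrow> a \<in> expos k n"
proof -
  have "(\<Sum>j=1..k. Poly_Mapping.lookup (bump a i) j) = (\<Sum>j=1..k. Poly_Mapping.lookup a j) + 1"
    using assms by (simp add: lookup_add lookup_single when_def sum.distrib)
  then show ?thesis using assms by (auto simp: expos_def keys_bump)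
qed

lemma expos_0: "expos k 0 = {0}"
proof -
  have "e = 0" if "e \<in> expos k 0" for e
  proof (rule poly_mapping_eqI)
    fix i
    have "i \<notin> Poly_Mapping.keys e" using that by (auto simp: expos_def in_keys_iff)
    then show "Poly_Mapping.lookup e i = Poly_Mapping.lookup 0 i" by (simp add: in_keys_iff)
  qed
  then show ?thesis by (auto simp: expos_def)
qed

lemma unbump:
  assumes "0 < Poly_Mapping.lookup e i"
  obtains a where "e = bump a i"
proof
  show "e = bump (e - Poly_Mapping.single i 1) i"
    by (rule poly_mapping_eqI) (use assms in \<open>auto simp: lookup_add lookup_minus lookup_single when_def\<close>)
qed

lemma expos_1: "expos k 1 = (\<lambda>i. Poly_Mapping.single i 1) ` {1..k}"
proof
  show "expos k 1 \<subseteq> (\<lambda>i. Poly_Mapping.single i 1) ` {1..k}"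
  proof
    fix e assume e: "e \<in> expos k 1"
    then have "(\<Sum>i=1..k. Poly_Mapping.lookup e i) \<noteq> 0" by (simp add: expos_def)
    then obtain i where i: "i \<in> {1..k}" "Poly_Mapping.lookup e i \<noteq> 0"
      by (meson sum.neutral)
    obtain a where a: "e = bump a i" using i unbump[of e i] by auto
    have "a \<in> expos k 0" using e bump_in_expos[OF i(1), of a 0] a by (simp add: One_nat_def)
    then show "e \<in> (\<lambda>i. Poly_Mapping.single i 1) ` {1..k}" using a i by (simp add: expos_0)
  qed
  show "(\<lambda>i. Poly_Mapping.single i 1) ` {1..k} \<subseteq> expos k 1"
    using bump_in_expos[of _ k 0 0] by (auto simp: expos_0 One_nat_def)
qed

lemma scale2_bit: "scale2 c p = (if c = 0 then 0 else p)"
  by (cases c) (auto simp: scale2_def)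

lemma poly2_double: "(p :: poly2) + p = 0"
proof (rule poly_mapping_eqI)
  have "b + b = 0" for b :: bit by (cases b) simp_all
  then show "Poly_Mapping.lookup (p + p) e = Poly_Mapping.lookup 0 e" for e
    by (simp only: lookup_add lookup_zero)
qed

lemma of_nat_bit_eq_0: "of_nat n = (0::bit) \<longleftrightarrow> even n"
  by (induction n) auto

text \<open>
  For a unit vector the product of binomials reduces to the factor \<open>a\<^sub>i\<close>, and only
  its parity matters: \<open>Sq\<^sup>1\<close> is the derivation with \<open>x\<^sub>i \<mapsto> x\<^sub>i\<^sup>2\<close>.
\<close>

lemma Sq_mon_1:
  assumes "Poly_Mapping.keys a \<subseteq> {1..k}"
  shows "Sq_mon k 1 a = (\<Sum>i\<in>odds a. monomial (bump a i))"
proof -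
  have inj: "inj_on (\<lambda>i. Poly_Mapping.single i (1::nat)) {1..k}"
    using inj_bump_index[of 0] by (auto intro!: inj_onI)
  have binom: "(\<Prod>j=1..k. Poly_Mapping.lookup a j choose Poly_Mapping.lookup (Poly_Mapping.single i 1) j)
      = Poly_Mapping.lookup a i" if "i \<in> {1..k}" for i
  proof -
    have "(\<Prod>j=1..k. Poly_Mapping.lookup a j choose Poly_Mapping.lookup (Poly_Mapping.single i 1) j)
       = (\<Prod>j=1..k. if j = i then Poly_Mapping.lookup a j else 1)"
      by (rule prod.cong) (auto simp: lookup_single when_def One_nat_def)
    also have "\<dots> = Poly_Mapping.lookup a i" using that by (simp add: One_nat_def)
    finally show ?thesis .
  qed
  have "Sq_mon k 1 a = (\<Sum>i\<in>{1..k}. if i \<in> odds a then monomial (bump a i) else 0)"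
    unfolding Sq_mon_def expos_1 sum.reindex[OF inj]
    by (rule sum.cong) (simp_all only: o_def binom scale2_bit of_nat_bit_eq_0 odds_def mem_Collect_eq, simp_all)
  also have "\<dots> = (\<Sum>i\<in>{1..k} \<inter> odds a. monomial (bump a i))"
    by (simp add: sum.inter_restrict)
  also have "{1..k} \<inter> odds a = odds a"
    using assms odds_subset_keys[of a] by auto
  finally show ?thesis .
qed

text \<open>
  The sum defining \<open>Sq\<close> runs over the support of its argument.  Additivity needs a range common to
  two polynomials.
\<close>

lemma Sq_superset:
  assumes "finite F" "Poly_Mapping.keys p \<subseteq> F"
  shows "Sq k r p = (\<Sum>a\<in>F. scale2 (Poly_Mapping.lookup p a) (Sq_mon k r a))"
  unfolding Sq_def
  by (rule sum.mono_neutral_left) (use assms in \<open>auto simp: in_keys_iff scale2_bit\<close>)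

lemma Sq_add: "Sq k r (p + q) = Sq k r p + Sq k r q"
proof -
  let ?F = "Poly_Mapping.keys p \<union> Poly_Mapping.keys q"
  have "Sq k r (p + q) = (\<Sum>a\<in>?F. scale2 (Poly_Mapping.lookup (p + q) a) (Sq_mon k r a))"
    by (rule Sq_superset) (use keys_add[of p q] in auto)
  also have "\<dots> = (\<Sum>a\<in>?F. scale2 (Poly_Mapping.lookup p a) (Sq_mon k r a))
      + (\<Sum>a\<in>?F. scale2 (Poly_Mapping.lookup q a) (Sq_mon k r a))"
    by (simp only: lookup_add poly2.scale_left_distrib sum.distrib)
  also have "\<dots> = Sq k r p + Sq k r q"
    by (simp add: Sq_superset[of ?F p] Sq_superset[of ?F q])
  finally show ?thesis .
qed

lemma Sq_0: "Sq k r 0 = 0"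
  by (simp add: Sq_def)

lemma Sq_sum: "Sq k r (\<Sum>i\<in>I. f i) = (\<Sum>i\<in>I. Sq k r (f i))"
  by (induction I rule: infinite_finite_induct) (auto simp: Sq_0 Sq_add)

lemma Sq_monomial: "Sq k r (monomial a) = Sq_mon k r a"
  by (simp add: Sq_def scale2_bit)

text \<open>
  In characteristic 2 the terms for \<open>(i, j)\<close> and \<open>(j, i)\<close> cancel.
\<close>

lemma symmetric_double_sum_zero:
  fixes f :: "nat \<Rightarrow> nat \<Rightarrow> poly2"
  assumes "finite A" and sym: "\<And>i j. f i j = f j i"
  shows "(\<Sum>i\<in>A. \<Sum>j\<in>A - {i}. f i j) = 0"
  using assms(1)
proof (induction A rule: finite_induct)
  case (insert x A)
  have "(\<Sum>j\<in>insert x A - {i}. f i j) = f x i + (\<Sum>j\<in>A - {i}. f i j)" if "i \<in> A" for i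
  proof -
    have "insert x A - {i} = insert x (A - {i})" using that insert.hyps by auto
    then show ?thesis using insert.hyps by (simp add: sym[of i x])
  qed
  then have "(\<Sum>i\<in>A. \<Sum>j\<in>insert x A - {i}. f i j)
      = (\<Sum>i\<in>A. f x i) + (\<Sum>i\<in>A. \<Sum>j\<in>A - {i}. f i j)"
    by (simp add: sum.distrib)
  then show ?case using insert by (simp add: poly2_double)
qed simp

text \<open>
  Raising the exponent at \<open>i\<close> makes it even, so the second application raises another odd exponent
  \<open>j\<close>; the result depends symmetrically on \<open>i\<close> and \<open>j\<close>.
\<close>

lemma Sq_1_Sq_1_monomial:
  assumes "Poly_Mapping.keys a \<subseteq> {1..k}"
  shows "Sq k 1 (Sq_mon k 1 a) = 0"
proof -
  have "Sq_mon k 1 (bump a i) = (\<Sum>j\<in>odds a - {i}. monomial (bump (bump a i) j))"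
    if i: "i \<in> odds a" for i
  proof -
    have "Poly_Mapping.keys (bump a i) \<subseteq> {1..k}"
      using assms i odds_subset_keys[of a] by (auto simp: keys_bump)
    then show ?thesis by (simp only: Sq_mon_1 odds_bump[OF i])
  qed
  then have "Sq k 1 (Sq_mon k 1 a)
      = (\<Sum>i\<in>odds a. \<Sum>j\<in>odds a - {i}. monomial (bump (bump a i) j))"
    by (simp add: Sq_mon_1[OF assms] Sq_sum Sq_monomial)
  also have "\<dots> = 0"
    by (rule symmetric_double_sum_zero) (simp_all add: finite_odds ac_simps)
  finally show ?thesis .
qed

section \<open>A monomial basis for the image of \<open>Sq\<^sup>1\<close>\<close>

definition first :: "expo \<Rightarrow> nat" where
  "first e = Min (Poly_Mapping.keys e)"

definition pivots :: "nat \<Rightarrow> nat \<Rightarrow> expo set" where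
  "pivots k n = {e \<in> expos k n. e \<noteq> 0 \<and> first e \<in> odds e}"

lemma finite_pivots: "finite (pivots k n)"
  by (rule finite_subset[OF _ finite_expos[of k n]]) (auto simp: pivots_def)

lemma pivotsD:
  assumes "e \<in> pivots k n"
  shows "e \<in> expos k n" "Poly_Mapping.keys e \<subseteq> {1..k}" "first e \<in> odds e" "first e \<in> {1..k}"
    "\<And>i. i \<in> Poly_Mapping.keys e \<Longrightarrow> first e \<le> i"
proof -
  show 1: "e \<in> expos k n" "Poly_Mapping.keys e \<subseteq> {1..k}" "first e \<in> odds e"
    using assms by (auto simp: pivots_def expos_def)
  then show "first e \<in> {1..k}" using odds_subset_keys by blast
  show "first e \<le> i" if "i \<in> Poly_Mapping.keys e" for i
    using that by (simp add: first_def)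
qed

lemma first_eqI:
  assumes "i \<in> Poly_Mapping.keys e" "\<And>j. j \<in> Poly_Mapping.keys e \<Longrightarrow> i \<le> j"
  shows "first e = i"
  unfolding first_def by (rule Min_eqI) (use assms in auto)

lemma first_bump_first: "e \<in> pivots k n \<Longrightarrow> first (bump e (first e)) = first e"
  by (rule first_eqI) (auto simp: keys_bump dest: pivotsD)

text \<open>
  The raised vector has the same first variable as the pivot, so that it tells which exponent to
  lower again.
\<close>

lemma inj_on_bump_first: "inj_on (\<lambda>e. bump e (first e)) (pivots k n)"
  by (rule inj_onI) (metis first_bump_first add_right_cancel)

lemma lookup_Sq_mon_1:
  assumes "Poly_Mapping.keys a \<subseteq> {1..k}"
  shows "Poly_Mapping.lookup (Sq_mon k 1 a) e \<noteq> 0 \<longleftrightarrow> (\<exists>i\<in>odds a. e = bump a i)"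
proof -
  have "Poly_Mapping.lookup (Sq_mon k 1 a) e = (\<Sum>i\<in>odds a. if e = bump a i then 1 else 0)"
    unfolding Sq_mon_1[OF assms]
    by (simp add: lookup_sum lookup_single when_def eq_commute)
  also have "\<dots> = (if \<exists>i\<in>odds a. e = bump a i then 1 else 0)"
  proof (cases "\<exists>i\<in>odds a. e = bump a i")
    case True
    then obtain i where i: "i \<in> odds a" "e = bump a i" by blast
    have "(\<Sum>j\<in>odds a. if e = bump a j then 1 else (0::bit)) = (\<Sum>j\<in>odds a. if i = j then 1 else 0)"
      unfolding i(2) inj_bump_index ..
    then show ?thesis using i finite_odds[of a] by auto
  qed (auto intro: sum.neutral)
  finally show ?thesis by simp
qed

lemma lead_Sq_pivot:
  assumes "a \<in> pivots k n"
  shows "Poly_Mapping.lookup (Sq_mon k 1 a) (bump a (first a)) = 1"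
    and "Poly_Mapping.lookup (Sq_mon k 1 a) e \<noteq> 0 \<Longrightarrow> e \<le> bump a (first a)"
proof -
  note a = pivotsD[OF assms]
  have "Poly_Mapping.lookup (Sq_mon k 1 a) (bump a (first a)) \<noteq> 0"
    unfolding lookup_Sq_mon_1[OF a(2)] using a(3) by blast
  then show "Poly_Mapping.lookup (Sq_mon k 1 a) (bump a (first a)) = 1" by simp
  assume "Poly_Mapping.lookup (Sq_mon k 1 a) e \<noteq> 0"
  then obtain i where "i \<in> odds a" "e = bump a i" unfolding lookup_Sq_mon_1[OF a(2)] by blast
  then show "e \<le> bump a (first a)"
    using a(5)[of i] odds_subset_keys[of a] bump_mono[of "first a" i a] by auto
qed

text \<open>
  In a linear relation, the largest leading exponent among the polynomials with nonzero coefficient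
  occurs in only one of them, and so cannot cancel.
\<close>

lemma independent_if_distinct_leads:
  fixes lead :: "poly2 \<Rightarrow> expo"
  assumes fin: "finite B" and inj: "inj_on lead B"
    and coeff: "\<And>p. p \<in> B \<Longrightarrow> Poly_Mapping.lookup p (lead p) = 1"
    and max: "\<And>p e. p \<in> B \<Longrightarrow> Poly_Mapping.lookup p e \<noteq> 0 \<Longrightarrow> e \<le> lead p"
  shows "poly2.independent B"
proof (rule poly2.independent_if_scalars_zero[OF fin], rule ccontr)
  fix f p
  assume sum0: "(\<Sum>q\<in>B. scale2 (f q) q) = 0" and p: "p \<in> B" "f p \<noteq> 0"
  let ?C = "{q \<in> B. f q \<noteq> 0}"
  have "finite (lead ` ?C)" "lead ` ?C \<noteq> {}" using fin p by auto
  then have "Max (lead ` ?C) \<in> lead ` ?C" by (rule Max_in)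
  then obtain q where q: "q \<in> ?C" and lead_q: "Max (lead ` ?C) = lead q" by blast
  have q_max: "lead r \<le> lead q" if "r \<in> ?C" for r
    unfolding lead_q[symmetric] by (rule Max_ge) (use fin that in auto)
  have "0 = (\<Sum>r\<in>B. Poly_Mapping.lookup (scale2 (f r) r) (lead q))"
    by (simp only: lookup_sum[symmetric] sum0 lookup_zero)
  also have "\<dots> = (\<Sum>r\<in>B. if q = r then 1 else 0)"
  proof (rule sum.cong)
    fix r assume r: "r \<in> B"
    show "Poly_Mapping.lookup (scale2 (f r) r) (lead q) = (if q = r then 1 else 0)"
    proof (cases "f r = 0 \<or> q = r")
      case True
      then show ?thesis using q coeff by (auto simp: scale2_bit)
    next
      case False
      then have "lead r \<le> lead q" "lead r \<noteq> lead q"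
        using q_max r inj q by (auto dest: inj_onD)
      then have "Poly_Mapping.lookup r (lead q) = 0" using max[OF r] by fastforce
      then show ?thesis using False by (simp add: scale2_bit)
    qed
  qed simp
  also have "\<dots> = 1" using q fin by auto
  finally show False by simp
qed

text \<open>
  The reduction step of the spanning argument: a monomial \<open>x\<^sup>a \<noteq> 1\<close> that is not a pivot differs from
  \<open>Sq\<^sup>1(x\<^sup>b)\<close>, with \<open>b\<close> obtained by lowering the first exponent, by a sum of pivots, and \<open>Sq\<^sup>1\<close>
  kills \<open>Sq\<^sup>1(x\<^sup>b)\<close>.
\<close>

lemma Sq_1_in_span_pivots:
  assumes a: "a \<in> expos k n"
  shows "Sq_mon k 1 a \<in> poly2.span (Sq_mon k 1 ` pivots k n)"
proof (cases "a = 0 \<or> a \<in> pivots k n")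
  case True
  have "Sq_mon k 1 0 = 0"
    by (subst Sq_mon_1) (auto simp: odds_def)
  with True show ?thesis by (auto intro: poly2.span_base poly2.span_zero)
next
  case False
  let ?m = "first a"
  have keys_a: "Poly_Mapping.keys a \<subseteq> {1..k}" using a by (simp add: expos_def)
  have m: "?m \<in> Poly_Mapping.keys a" using False by (simp add: first_def)
  have m_even: "?m \<notin> odds a" using False a by (auto simp: pivots_def)
  obtain b where b: "a = bump b ?m" using unbump[of a ?m] m by (auto simp: in_keys_iff)
  have mk: "?m \<in> {1..k}" using m keys_a by blast
  have la: "Poly_Mapping.lookup a ?m = Poly_Mapping.lookup b ?m + 1"
    by (subst b) (simp add: lookup_add)
  then have mb: "?m \<in> odds b" using m_even by (simp add: odds_def)
  have keys_b: "Poly_Mapping.keys b = Poly_Mapping.keys a"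
    using keys_bump[of b ?m] b mb odds_subset_keys[of b] by auto
  have kb: "Poly_Mapping.keys b \<subseteq> {1..k}" using keys_a keys_b by simp
  have n: "n \<noteq> 0" using a False expos_0[of k] by (metis singletonD)
  then obtain n' where n': "n = Suc n'" by (cases n) auto
  have b_deg: "b \<in> expos k n'" using bump_in_expos[OF mk, of b n'] a b n' by simp
  \<comment> \<open>Raising any other odd exponent leaves the exponent at \<open>?m\<close> odd and the support unchanged.\<close>
  have piv: "bump b i \<in> pivots k n" if i: "i \<in> odds b - {?m}" for i
  proof -
    have ik: "i \<in> Poly_Mapping.keys a" using i odds_subset_keys[of b] keys_b by auto
    have ks: "Poly_Mapping.keys (bump b i) = Poly_Mapping.keys a"
      using ik by (auto simp: keys_bump keys_b)
    have "first (bump b i) = ?m" by (simp add: first_def ks)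
    moreover have "?m \<in> odds (bump b i)" using i mb by (simp add: odds_bump)
    moreover have "bump b i \<in> expos k n" using bump_in_expos[of i k b n'] b_deg n' ik keys_a by auto
    moreover have "bump b i \<noteq> 0" using ks m by auto
    ultimately show ?thesis by (simp add: pivots_def)
  qed
  have "Sq_mon k 1 b = monomial a + (\<Sum>i\<in>odds b - {?m}. monomial (bump b i))"
    using sum.remove[OF finite_odds mb, of "\<lambda>i. monomial (bump b i)"] b
    unfolding Sq_mon_1[OF kb] by metis
  then have "Sq k 1 (Sq_mon k 1 b) = Sq_mon k 1 a + (\<Sum>i\<in>odds b - {?m}. Sq_mon k 1 (bump b i))"
    by (simp add: Sq_add Sq_sum Sq_monomial)
  then have "Sq_mon k 1 a + (\<Sum>i\<in>odds b - {?m}. Sq_mon k 1 (bump b i)) = 0"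
    using Sq_1_Sq_1_monomial[OF kb] by simp
  then have "Sq_mon k 1 a = (\<Sum>i\<in>odds b - {?m}. Sq_mon k 1 (bump b i))"
    by (metis poly2_double add_right_cancel)
  also have "\<dots> \<in> poly2.span (Sq_mon k 1 ` pivots k n)"
    by (intro poly2.span_sum poly2.span_base imageI piv)
  finally show ?thesis .
qed

lemma rho_eq_card_pivots: "rho k n = card (pivots k n)"
proof -
  define B where "B = Sq_mon k 1 ` pivots k n"
  define lead where "lead p = Max (Poly_Mapping.keys p)" for p :: poly2
  have lead: "lead (Sq_mon k 1 a) = bump a (first a)" if a: "a \<in> pivots k n" for a
    unfolding lead_def
    by (rule Max_eqI) (use lead_Sq_pivot[OF a] in \<open>auto simp: in_keys_iff\<close>)
  have inj: "inj_on (Sq_mon k 1) (pivots k n)"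
    by (rule inj_onI) (metis lead inj_onD[OF inj_on_bump_first])
  have card_B: "card B = card (pivots k n)" unfolding B_def by (rule card_image[OF inj])
  have "poly2.independent B"
  proof (rule independent_if_distinct_leads[where lead = lead])
    show "finite B" by (simp add: B_def finite_pivots)
    show "inj_on lead B"
      by (rule inj_onI) (auto simp: B_def lead dest: inj_onD[OF inj_on_bump_first])
  qed (auto simp: B_def lead lead_Sq_pivot)
  moreover have "B \<subseteq> Sq k 1 ` homog k n"
  proof
    fix p assume "p \<in> B"
    then obtain a where "a \<in> pivots k n" "p = Sq k 1 (monomial a)" by (auto simp: B_def Sq_monomial)
    then show "p \<in> Sq k 1 ` homog k n" by (auto simp: homog_def pivots_def)
  qed
  moreover have "Sq k 1 ` homog k n \<subseteq> poly2.span B"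
    unfolding B_def Sq_def homog_def
    by (auto intro!: poly2.span_sum poly2.span_scale intro: Sq_1_in_span_pivots)
  ultimately show ?thesis
    unfolding rho_def using card_B by (intro poly2.dim_unique)
qed

section \<open>Monotonicity\<close>

text \<open>
  Raising the first exponent by 2 keeps its parity and the support.
\<close>

lemma card_pivots_add_two: "card (pivots k n) \<le> card (pivots k (n + 2))"
proof (rule card_inj_on_le)
  let ?f = "\<lambda>e. bump (bump e (first e)) (first e)"
  have f: "first (?f e) = first e" if "e \<in> pivots k n" for e
    by (rule first_eqI) (use that in \<open>auto simp: keys_bump dest: pivotsD\<close>)
  show "inj_on ?f (pivots k n)"
    by (rule inj_onI) (metis f add_right_cancel)
  show "?f ` pivots k n \<subseteq> pivots k (n + 2)"
  proof safe
    fix e assume e: "e \<in> pivots k n"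
    have "?f e \<in> expos k (n + 2)"
      using bump_in_expos[OF pivotsD(4)[OF e], of e n]
        bump_in_expos[OF pivotsD(4)[OF e], of "bump e (first e)" "Suc n"] pivotsD(1)[OF e] by simp
    moreover have "first e \<in> odds (?f e)"
      using pivotsD(3)[OF e] by (simp add: odds_def lookup_add)
    moreover have "?f e \<noteq> 0" using keys_bump[of "bump e (first e)" "first e"] by auto
    ultimately show "?f e \<in> pivots k (n + 2)" by (simp add: pivots_def f[OF e])
  qed
qed (rule finite_pivots)

text \<open>
  The injection raises the last exponent.  It would spoil a pivot that is a power of the last
  variable, but such a pivot has odd degree.
\<close>

lemma card_pivots_even_Suc:
  assumes "even n"
  shows "card (pivots k n) \<le> card (pivots k (Suc n))"
proof (rule card_inj_on_le)
  let ?f = "\<lambda>e. bump e k"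
  show "inj_on ?f (pivots k n)" by (rule inj_onI) simp
  show "?f ` pivots k n \<subseteq> pivots k (Suc n)"
  proof safe
    fix e assume e: "e \<in> pivots k n"
    have "first e \<noteq> k"
    proof
      assume eq: "first e = k"
      have "Poly_Mapping.keys e = {k}"
        using pivotsD[OF e] odds_subset_keys[of e] unfolding eq by fastforce
      then have "Poly_Mapping.lookup e k = n"
        using pivotsD(1,2)[OF e] expos_sum_keys[of e k] by (simp add: expos_def)
      then show False using assms pivotsD(3)[OF e] eq by (simp add: odds_def)
    qed
    then have lt: "first e < k" using pivotsD(4)[OF e] by auto
    then have "first (?f e) = first e"
      using pivotsD[OF e] odds_subset_keys[of e] by (intro first_eqI) (auto simp: keys_bump)
    moreover have "first e \<in> odds (?f e)"
      using pivotsD(3)[OF e] lt by (simp add: odds_def lookup_add lookup_single when_def)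
    moreover have "?f e \<in> expos k (Suc n)"
      using bump_in_expos[of k k e n] pivotsD(1)[OF e] lt by auto
    moreover have "?f e \<noteq> 0" using keys_bump[of e k] by auto
    ultimately show "?f e \<in> pivots k (Suc n)" by (simp add: pivots_def)
  qed
qed (rule finite_pivots)

lemma card_pivots_add_even: "card (pivots k n) \<le> card (pivots k (n + 2 * j))"
proof (induction j)
  case (Suc j)
  then show ?case using card_pivots_add_two[of k "n + 2 * j"] by simp
qed simp

lemma card_pivots_le_odd:
  assumes "n \<le> m" "odd m"
  shows "card (pivots k n) \<le> card (pivots k m)"
proof (cases "even n")
  case True
  then have "Suc n \<le> m" "even (m - Suc n)" using assms by (auto simp: Suc_le_eq le_less)
  then obtain j where "m = Suc n + 2 * j" by (metis dvdE le_add_diff_inverse)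
  then show ?thesis
    using card_pivots_even_Suc[OF True, of k] card_pivots_add_even[of k "Suc n" j] by simp
next
  case False
  then have "even (m - n)" using assms by simp
  then obtain j where "m = n + 2 * j" using assms by (metis dvdE le_add_diff_inverse)
  then show ?thesis using card_pivots_add_even[of k n j] by simp
qed

section \<open>Counting pivots by their odd exponents\<close>

text \<open>
  The degree, as a sum over the support instead of over \<open>{1..k}\<close>, so that compositions
  supported on a given set can be counted without mentioning \<open>k\<close>.
\<close>

definition total :: "expo \<Rightarrow> nat" where
  "total c = (\<Sum>i\<in>Poly_Mapping.keys c. Poly_Mapping.lookup c i)"

definition with_support :: "nat set \<Rightarrow> nat \<Rightarrow> expo set" where
  "with_support S M = {c. Poly_Mapping.keys c = S \<and> total c = M}"

lemma total_superset:
  assumes "finite S" "Poly_Mapping.keys c \<subseteq> S"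
  shows "total c = (\<Sum>i\<in>S. Poly_Mapping.lookup c i)"
  unfolding total_def
  by (rule sum.mono_neutral_left) (use assms in \<open>auto simp: in_keys_iff\<close>)

lemma total_bump: "total (bump c x) = Suc (total c)"
proof -
  let ?S = "insert x (Poly_Mapping.keys c)"
  have "total (bump c x) = (\<Sum>i\<in>?S. Poly_Mapping.lookup (bump c x) i)"
    by (rule total_superset) (simp_all add: keys_bump)
  also have "\<dots> = (\<Sum>i\<in>?S. Poly_Mapping.lookup c i) + (\<Sum>i\<in>?S. if x = i then 1 else 0)"
    by (simp only: lookup_add sum.distrib lookup_single when_def)
  also have "(\<Sum>i\<in>?S. Poly_Mapping.lookup c i) = total c"
    by (rule total_superset[symmetric]) auto
  also have "(\<Sum>i\<in>?S. if x = i then 1 else (0::nat)) = 1"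
    by (simp only: sum.delta' finite_insert finite_keys) simp
  finally show ?thesis by simp
qed

lemma total_eq_0: "total c = 0 \<longleftrightarrow> c = 0"
proof
  assume "total c = 0"
  then have "\<forall>i\<in>Poly_Mapping.keys c. Poly_Mapping.lookup c i = 0" by (simp add: total_def)
  then show "c = 0" by (intro poly_mapping_eqI) (metis in_keys_iff lookup_zero)
qed (simp add: total_def)

lemma expos_iff: "e \<in> expos k n \<longleftrightarrow> Poly_Mapping.keys e \<subseteq> {1..k} \<and> total e = n"
  using expos_sum_keys[of e k] by (auto simp: expos_def total_def)

lemma with_support_0: "with_support S 0 = (if S = {} then {0} else {})"
  by (auto simp: with_support_def total_eq_0)

lemma with_support_empty: "with_support {} (Suc M) = {}"
  by (auto simp: with_support_def total_def)

text \<open>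
  Lowering the part at \<open>x\<close> by 1 either keeps \<open>x\<close> in the support or removes it.  This is Pascal's
  rule for compositions and drives the induction in \<open>card_with_support\<close>.
\<close>

lemma with_support_insert:
  assumes "x \<notin> S"
  shows "with_support (insert x S) (Suc M)
    = (\<lambda>c. bump c x) ` (with_support (insert x S) M \<union> with_support S M)"
proof
  show "with_support (insert x S) (Suc M)
    \<subseteq> (\<lambda>c. bump c x) ` (with_support (insert x S) M \<union> with_support S M)"
  proof
    fix e assume e: "e \<in> with_support (insert x S) (Suc M)"
    then have "x \<in> Poly_Mapping.keys e" by (simp add: with_support_def)
    then obtain c where c: "e = bump c x" using unbump[of e x] by (auto simp: in_keys_iff)
    then have "total c = M" "insert x (Poly_Mapping.keys c) = insert x S"
      using e by (auto simp: with_support_def total_bump keys_bump)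
    then have "c \<in> with_support (insert x S) M \<union> with_support S M"
      using assms by (cases "x \<in> Poly_Mapping.keys c") (auto simp: with_support_def)
    then show "e \<in> (\<lambda>c. bump c x) ` (with_support (insert x S) M \<union> with_support S M)"
      using c by blast
  qed
  show "(\<lambda>c. bump c x) ` (with_support (insert x S) M \<union> with_support S M)
    \<subseteq> with_support (insert x S) (Suc M)"
  proof (rule image_subsetI)
    fix c assume c: "c \<in> with_support (insert x S) M \<union> with_support S M"
    have "Poly_Mapping.keys (bump c x) = insert x S" "total (bump c x) = Suc M"
      unfolding keys_bump total_bump using c unfolding with_support_def by blast+
    then show "bump c x \<in> with_support (insert x S) (Suc M)"
      unfolding with_support_def by blast
  qed
qed

lemma finite_with_support: "finite S \<Longrightarrow> finite (with_support S M)"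
proof (induction M arbitrary: S)
  case (Suc M)
  show ?case
  proof (cases "S = {}")
    case False
    then obtain x S' where "S = insert x S'" "x \<notin> S'" by (metis ex_in_conv mk_disjoint_insert)
    then show ?thesis using Suc by (simp add: with_support_insert)
  qed (simp add: with_support_empty)
qed (simp add: with_support_0)

lemma card_with_support:
  assumes "finite S" "S \<noteq> {}"
  shows "card (with_support S (Suc M)) = M choose (card S - 1)"
  using assms
proof (induction M arbitrary: S)
  case (0 S)
  then obtain x S' where S: "S = insert x S'" "x \<notin> S'" by (metis ex_in_conv mk_disjoint_insert)
  then show ?case using 0 by (auto simp: with_support_insert with_support_0 card_gt_0_iff)
next
  case (Suc M S)
  then obtain x S' where S: "S = insert x S'" "x \<notin> S'" by (metis ex_in_conv mk_disjoint_insert)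
  have fin: "finite S'" using Suc S by simp
  have "card (with_support S (Suc (Suc M)))
      = card (with_support S (Suc M) \<union> with_support S' (Suc M))"
    unfolding S(1) with_support_insert[OF S(2), of "Suc M"]
    by (rule card_image) (auto intro: inj_onI)
  also have "\<dots> = card (with_support S (Suc M)) + card (with_support S' (Suc M))"
    by (rule card_Un_disjoint) (use S fin in \<open>auto simp: finite_with_support\<close>, auto simp: with_support_def)
  also have "\<dots> = Suc M choose (card S - 1)"
  proof (cases "S' = {}")
    case True
    then show ?thesis using Suc.IH[of S] Suc.prems S by (simp add: with_support_empty)
  next
    case False
    then have "card S' = Suc (card S' - 1)" using fin by (simp add: card_gt_0_iff)
    then obtain s where "card S' = Suc s" by blast
    then show ?thesis using Suc.IH[of S] Suc.IH[of S'] Suc.prems S fin False by simp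
  qed
  finally show ?case .
qed

lemma card_subsets_containing:
  assumes "finite S" "m \<in> S" "1 \<le> q"
  shows "card {J. J \<subseteq> S \<and> m \<in> J \<and> card J = q} = (card S - 1) choose (q - 1)"
proof -
  have "{J. J \<subseteq> S \<and> m \<in> J \<and> card J = q}
      = insert m ` {K. K \<subseteq> S - {m} \<and> card K = q - 1}" (is "?L = _ ` ?R")
  proof
    show "?L \<subseteq> insert m ` ?R"
    proof
      fix J assume J: "J \<in> ?L"
      then have "finite J" using assms finite_subset by auto
      then have "J - {m} \<in> ?R" using J by auto
      moreover have "J = insert m (J - {m})" using J by auto
      ultimately show "J \<in> insert m ` ?R" by blast
    qed
    show "insert m ` ?R \<subseteq> ?L"
    proof safe
      fix K assume K: "K \<subseteq> S - {m}" "card K = q - 1"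
      then have "finite K" "m \<notin> K" using assms finite_subset by auto
      then show "card (insert m K) = q" using K assms by simp
    qed (use assms in auto)
  qed
  moreover have "inj_on (insert m) ?R"
    by (rule inj_onI) (auto dest: insert_ident[THEN iffD1, rotated 2])
  ultimately have "card ?L = card ?R" by (simp add: card_image)
  also have "\<dots> = (card S - 1) choose (q - 1)"
    using assms by (simp add: n_subsets)
  finally show ?thesis .
qed

text \<open>
  \<open>halve\<close> extracts \<open>c\<close> from \<open>e = 2c - 1\<^sub>J\<close>, and \<open>unhalve J\<close> recovers \<open>e\<close>.  Halves are rounded up, so
  that \<open>c\<close> has the same support as \<open>e\<close>; the natural subtraction is exact when \<open>J\<close> lies in the
  support of \<open>c\<close>.
\<close>

definition halve :: "expo \<Rightarrow> expo" where
  "halve e = Poly_Mapping.map (\<lambda>v. (v + 1) div 2) e"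

definition unhalve :: "nat set \<Rightarrow> expo \<Rightarrow> expo" where
  "unhalve J c = Poly_Mapping.mapp (\<lambda>i v. 2 * v - of_bool (i \<in> J)) c"

lemma lookup_halve: "Poly_Mapping.lookup (halve e) i = (Poly_Mapping.lookup e i + 1) div 2"
  by (simp add: halve_def map.rep_eq when_def)

lemma lookup_unhalve:
  "Poly_Mapping.lookup (unhalve J c) i = 2 * Poly_Mapping.lookup c i - of_bool (i \<in> J)"
  by (simp add: unhalve_def lookup_mapp when_def in_keys_iff)

lemma keys_halve: "Poly_Mapping.keys (halve e) = Poly_Mapping.keys e"
  by (auto simp: in_keys_iff lookup_halve)

lemma keys_unhalve: "Poly_Mapping.keys (unhalve J c) = Poly_Mapping.keys c"
  by (auto simp: in_keys_iff lookup_unhalve)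

lemma odds_unhalve: "J \<subseteq> Poly_Mapping.keys c \<Longrightarrow> odds (unhalve J c) = J"
  by (auto simp: odds_def lookup_unhalve in_keys_iff subset_iff)

lemma halve_unhalve: "J \<subseteq> Poly_Mapping.keys c \<Longrightarrow> halve (unhalve J c) = c"
proof (rule poly_mapping_eqI)
  fix i assume "J \<subseteq> Poly_Mapping.keys c"
  then have "i \<in> J \<Longrightarrow> Poly_Mapping.lookup c i > 0" by (auto simp: in_keys_iff)
  then show "Poly_Mapping.lookup (halve (unhalve J c)) i = Poly_Mapping.lookup c i"
    by (cases "i \<in> J") (simp_all add: lookup_halve lookup_unhalve)
qed

lemma unhalve_halve: "unhalve (odds e) (halve e) = e"
  by (rule poly_mapping_eqI) (auto simp: lookup_halve lookup_unhalve odds_def elim!: evenE oddE)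

lemma total_halve: "2 * total (halve e) = total e + card (odds e)"
proof -
  have "2 * total (halve e)
      = (\<Sum>i\<in>Poly_Mapping.keys e. Poly_Mapping.lookup e i + (if i \<in> odds e then 1 else 0))"
    unfolding total_def keys_halve sum_distrib_left
    by (rule sum.cong) (auto simp: lookup_halve odds_def elim!: evenE oddE)
  also have "\<dots> = total e + card (Poly_Mapping.keys e \<inter> odds e)"
    by (simp add: sum.distrib total_def flip: sum.inter_restrict)
  also have "Poly_Mapping.keys e \<inter> odds e = odds e" using odds_subset_keys[of e] by auto
  finally show ?thesis .
qed

definition pivot_data :: "nat \<Rightarrow> nat \<Rightarrow> nat \<Rightarrow> (nat set \<times> nat set \<times> expo) set" where
  "pivot_data k q M = (SIGMA S : Pow {1..k} - {{}}.
     {J. J \<subseteq> S \<and> Min S \<in> J \<and> card J = q} \<times> with_support S M)"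

lemma bij_betw_pivot_data:
  assumes "n + q = 2 * M"
  shows "bij_betw (\<lambda>e. (Poly_Mapping.keys e, odds e, halve e))
    {e \<in> pivots k n. card (odds e) = q} (pivot_data k q M)"
proof (rule bij_betw_byWitness[where f' = "\<lambda>(S, J, c). unhalve J c"])
  show "\<forall>e\<in>{e \<in> pivots k n. card (odds e) = q}.
      (case (Poly_Mapping.keys e, odds e, halve e) of (S, J, c) \<Rightarrow> unhalve J c) = e"
    by (simp add: unhalve_halve)
  show "\<forall>z\<in>pivot_data k q M. (\<lambda>e. (Poly_Mapping.keys e, odds e, halve e))
      (case z of (S, J, c) \<Rightarrow> unhalve J c) = z"
    by (auto simp: pivot_data_def with_support_def keys_unhalve odds_unhalve halve_unhalve)
  show "(\<lambda>e. (Poly_Mapping.keys e, odds e, halve e)) ` {e \<in> pivots k n. card (odds e) = q}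
      \<subseteq> pivot_data k q M"
  proof safe
    fix e assume e: "e \<in> pivots k n" "q = card (odds e)"
    have "total (halve e) = M"
      using total_halve[of e] assms e pivotsD(1)[OF e(1)] by (simp add: expos_iff)
    then show "(Poly_Mapping.keys e, odds e, halve e) \<in> pivot_data k (card (odds e)) M"
      using e odds_subset_keys[of e]
      by (auto simp: pivot_data_def with_support_def keys_halve pivots_def first_def expos_iff)
  qed
  show "(\<lambda>(S, J, c). unhalve J c) ` pivot_data k q M \<subseteq> {e \<in> pivots k n. card (odds e) = q}"
  proof safe
    fix S J c assume z: "(S, J, c) \<in> pivot_data k q M"
    then have c: "Poly_Mapping.keys c = S" "total c = M" "S \<subseteq> {1..k}" "S \<noteq> {}"
      and J: "J \<subseteq> Poly_Mapping.keys c" "Min S \<in> J" "card J = q"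
      by (auto simp: pivot_data_def with_support_def)
    have "total (unhalve J c) = n"
      using total_halve[of "unhalve J c"] assms c J by (simp add: halve_unhalve odds_unhalve)
    moreover have "unhalve J c \<noteq> 0" using keys_unhalve[of J c] c by auto
    ultimately show "unhalve J c \<in> pivots k n"
      using c J by (auto simp: pivots_def expos_iff first_def keys_unhalve odds_unhalve)
    show "card (odds (unhalve J c)) = q" using J by (simp add: odds_unhalve)
  qed
qed

lemma sum_over_subsets_by_card:
  assumes "finite A"
  shows "(\<Sum>S\<in>Pow A. g (card S)) = (\<Sum>s=0..card A. (card A choose s) * (g s :: nat))"
proof -
  have "(\<Sum>S\<in>Pow A. g (card S)) = (\<Sum>s=0..card A. \<Sum>S\<in>{S \<in> Pow A. card S = s}. g (card S))"
    by (rule sum.group[symmetric]) (use assms in \<open>auto intro: card_mono\<close>)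
  also have "\<dots> = (\<Sum>s=0..card A. (card A choose s) * g s)"
    by (rule sum.cong) (use assms in \<open>auto simp: n_subsets Pow_def\<close>)
  finally show ?thesis .
qed

text \<open>
  The triples of \<open>pivot_data\<close> with support of size \<open>s\<close> give the summand for \<open>s\<close>.  The
  summation bounds only cut off zeros: \<open>s - 1 choose q - 1\<close> vanishes for \<open>0 < s < q\<close>, and
  \<open>N + q - 1 choose s - 1\<close> for \<open>s > N + q\<close>.
\<close>

lemma card_pivots_odds:
  assumes q: "1 \<le> q"
  shows "card {e \<in> pivots k (2 * N + q). card (odds e) = q}
    = (\<Sum>s=q..min k (N + q). ((s - 1) choose (q - 1)) * (k choose s) * ((N + q - 1) choose (s - 1)))"
proof -
  \<comment> \<open>For \<open>s = 0\<close> and \<open>q = 1\<close>, natural subtraction would make the product of the two binomials 1.\<close>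
  let ?g = "\<lambda>s. if s = 0 then 0 else ((s - 1) choose (q - 1)) * ((N + q - 1) choose (s - 1))"
  have "card {e \<in> pivots k (2 * N + q). card (odds e) = q} = card (pivot_data k q (N + q))"
    by (rule bij_betw_same_card[OF bij_betw_pivot_data]) simp
  also have "\<dots> = (\<Sum>S\<in>Pow {1..k} - {{}}.
      card ({J. J \<subseteq> S \<and> Min S \<in> J \<and> card J = q} \<times> with_support S (N + q)))"
    unfolding pivot_data_def
  proof (rule card_SigmaI)
    show "\<forall>S\<in>Pow {1..k} - {{}}.
        finite ({J. J \<subseteq> S \<and> Min S \<in> J \<and> card J = q} \<times> with_support S (N + q))"
    proof
      fix S assume "S \<in> Pow {1..k} - {{}}"
      then have "finite S" by (auto intro: finite_subset)
      then show "finite ({J. J \<subseteq> S \<and> Min S \<in> J \<and> card J = q} \<times> with_support S (N + q))"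
        by (intro finite_cartesian_product finite_with_support) simp_all
    qed
  qed simp
  also have "\<dots> = (\<Sum>S\<in>Pow {1..k} - {{}}. ?g (card S))"
  proof (rule sum.cong)
    fix S assume "S \<in> Pow {1..k} - {{}}"
    then have S: "finite S" "S \<noteq> {}" by (auto intro: finite_subset)
    have "N + q = Suc (N + q - 1)" using q by simp
    then have "card (with_support S (N + q)) = (N + q - 1) choose (card S - 1)"
      using card_with_support[OF S, of "N + q - 1"] by simp
    then show "card ({J. J \<subseteq> S \<and> Min S \<in> J \<and> card J = q} \<times> with_support S (N + q)) = ?g (card S)"
      using S q by (simp add: card_cartesian_product card_subsets_containing)
  qed simp
  also have "\<dots> = (\<Sum>S\<in>Pow {1..k}. ?g (card S))"
    by (rule sum.mono_neutral_left) auto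
  also have "\<dots> = (\<Sum>s=0..k. (k choose s) * ?g s)"
    using sum_over_subsets_by_card[of "{1..k}" ?g] by simp
  also have "\<dots> = (\<Sum>s=q..min k (N + q). (k choose s) * ?g s)"
    by (rule sum.mono_neutral_right) (use q in \<open>auto simp: not_le\<close>)
  also have "\<dots> = (\<Sum>s=q..min k (N + q). ((s - 1) choose (q - 1)) * (k choose s) * ((N + q - 1) choose (s - 1)))"
    by (rule sum.cong) (use q in auto)
  finally show ?thesis .
qed

section \<open>The numbers \<open>B\<^sub>t\<close>\<close>

lemma B_N_eq_iff: "B_N t q d = of_nat N \<longleftrightarrow> d = 2 ^ t * (2 * N + q + 1)"
proof -
  have "B_N t q d = of_nat N \<longleftrightarrow> (of_nat d :: rat) = of_nat (2 ^ t * (2 * N + q + 1))"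
    unfolding B_N_def by (auto simp: field_simps)
  then show ?thesis by (simp only: of_nat_eq_iff)
qed

text \<open>
  When \<open>d / R = m\<close> is not of the form \<open>2N + q + 1\<close>, both sides vanish: a vector of degree \<open>m - 1\<close> with
  \<open>q\<close> odd entries has \<open>m - 1 - q\<close> even and nonnegative.
\<close>

lemma Btq_eq_card:
  assumes q: "1 \<le> q" and d: "1 \<le> d" "2 ^ t dvd d"
  shows "Btq t q k d = card {e \<in> pivots k (d div 2 ^ t - 1). card (odds e) = q}"
proof -
  obtain m where m: "d = 2 ^ t * m" using d by blast
  then have m1: "1 \<le> m" and div: "d div 2 ^ t = m" using d by (cases m; simp)+
  show ?thesis
  proof (cases "\<exists>N. m = 2 * N + q + 1")
    case True
    then obtain N where N: "m = 2 * N + q + 1" by blast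
    then have "B_N t q d = of_nat N" using m by (simp add: B_N_eq_iff)
    then show ?thesis
      using card_pivots_odds[OF q, of k N] N div by (simp add: Btq_def Let_def)
  next
    case False
    then have "B_N t q d \<notin> \<nat>" using m by (auto elim!: Nats_cases simp: B_N_eq_iff)
    moreover have "{e \<in> pivots k (m - 1). card (odds e) = q} = {}"
    proof safe
      fix e assume e: "e \<in> pivots k (m - 1)" "q = card (odds e)"
      have "card (odds e) \<le> total (halve e)"
      proof -
        have "card (odds e) \<le> card (Poly_Mapping.keys (halve e))"
          by (rule card_mono) (auto simp: keys_halve odds_subset_keys)
        also have "\<dots> = (\<Sum>i\<in>Poly_Mapping.keys (halve e). 1)" by simp
        also have "\<dots> \<le> total (halve e)"
          unfolding total_def by (rule sum_mono) (simp add: in_keys_iff)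
        finally show ?thesis .
      qed
      moreover have "2 * total (halve e) = m - 1 + q"
        using total_halve[of e] e pivotsD(1)[OF e(1)] by (simp add: expos_iff)
      ultimately have "m = 2 * (total (halve e) - q) + q + 1" using m1 e(2) by simp
      then show "e \<in> {}" using False by blast
    qed
    ultimately show ?thesis using div by (simp only: Btq_def if_False card.empty)
  qed
qed

text \<open>
  A pivot has at least one odd exponent, its first, so the range \<open>1 \<le> q \<le> k\<close> covers all pivots.
\<close>

lemma Bt_eq_card:
  assumes "1 \<le> d" "2 ^ t dvd d"
  shows "Bt t k d = card (pivots k (d div 2 ^ t - 1))"
proof -
  let ?P = "pivots k (d div 2 ^ t - 1)"
  have "Bt t k d = (\<Sum>q=1..k. \<Sum>e\<in>{e \<in> ?P. card (odds e) = q}. 1)"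
    unfolding Bt_def by (rule sum.cong) (simp_all add: Btq_eq_card assms)
  also have "\<dots> = (\<Sum>e\<in>?P. 1)"
  proof (rule sum.group)
    show "(\<lambda>e. card (odds e)) ` ?P \<subseteq> {1..k}"
    proof safe
      fix e assume e: "e \<in> ?P"
      have "0 < card (odds e)" using pivotsD(3)[OF e] finite_odds[of e] by (auto simp: card_gt_0_iff)
      moreover have "card (odds e) \<le> card {1..k}"
        using pivotsD(2)[OF e] odds_subset_keys[of e] by (intro card_mono) auto
      ultimately show "card (odds e) \<in> {1..k}" by simp
    qed
  qed (simp_all add: finite_pivots)
  finally show ?thesis by simp
qed

lemma Bt_eq_0: "\<not> 2 ^ t dvd d \<Longrightarrow> Bt t k d = 0"
  unfolding Bt_def Btq_def by (auto elim!: Nats_cases simp: B_N_eq_iff)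

section \<open>Leading monomials of the hit matrix\<close>

lemma hit_matrix_0:
  assumes "1 \<le> d"
  shows "hit_matrix k d e (0, a) = Poly_Mapping.lookup (Sq_mon k 1 a) e"
proof -
  have fin: "finite {t::nat. 2 ^ t \<le> d}"
    by (rule finite_subset[of _ "{..d}"]) (auto intro: order.trans less_imp_le[OF less_exp])
  have "hit_map k d (hit_basis (0, a)) = (\<Sum>t\<in>{t. 2 ^ t \<le> d}. if t = 0 then Sq_mon k 1 a else 0)"
    unfolding hit_map_def hit_basis_def
    by (rule sum.cong) (auto simp: Sq_monomial Sq_0)
  also have "\<dots> = Sq_mon k 1 a" using assms fin by simp
  finally show ?thesis by (simp add: hit_matrix_def)
qed

text \<open>
  The columns indexed by \<open>(0, a)\<close> with \<open>a\<close> a pivot already have pairwise different leading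
  monomials.
\<close>

lemma card_pivots_le_lambda_lex_hit:
  assumes d: "1 \<le> d"
  shows "card (pivots k (d - 1)) \<le> lambda_lex_hit k d"
proof -
  let ?L = "{Max {e \<in> expos k d. hit_matrix k d e c \<noteq> 0} | c.
    c \<in> hit_cols k d \<and> (\<exists>e\<in>expos k d. hit_matrix k d e c \<noteq> 0)}"
  have "?L \<subseteq> expos k d"
  proof safe
    fix c e assume "e \<in> expos k d" "hit_matrix k d e c \<noteq> 0"
    then have "Max {e \<in> expos k d. hit_matrix k d e c \<noteq> 0} \<in> {e \<in> expos k d. hit_matrix k d e c \<noteq> 0}"
      by (intro Max_in) (auto simp: finite_expos)
    then show "Max {e \<in> expos k d. hit_matrix k d e c \<noteq> 0} \<in> expos k d" by blast
  qed
  then have fin: "finite ?L" using finite_expos finite_subset by blast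
  have "(\<lambda>a. bump a (first a)) ` pivots k (d - 1) \<subseteq> ?L"
  proof safe
    fix a assume a: "a \<in> pivots k (d - 1)"
    have in_d: "bump a (first a) \<in> expos k d"
      using bump_in_expos[OF pivotsD(4)[OF a], of a "d - 1"] pivotsD(1)[OF a] d by simp
    have M: "hit_matrix k d (bump a (first a)) (0, a) \<noteq> 0"
      unfolding hit_matrix_0[OF d] lead_Sq_pivot(1)[OF a] by simp
    have "Max {e \<in> expos k d. hit_matrix k d e (0, a) \<noteq> 0} = bump a (first a)"
      by (rule Max_eqI)
        (use in_d M lead_Sq_pivot(2)[OF a] in \<open>auto simp: finite_expos hit_matrix_0[OF d]\<close>)
    moreover have "(0, a) \<in> hit_cols k d" using d pivotsD(1)[OF a] by (simp add: hit_cols_def)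
    ultimately show "\<exists>c. bump a (first a) = Max {e \<in> expos k d. hit_matrix k d e c \<noteq> 0} \<and>
        c \<in> hit_cols k d \<and> (\<exists>e\<in>expos k d. hit_matrix k d e c \<noteq> 0)"
      using in_d M by (intro exI[of _ "(0, a)"]) auto
  qed
  then have "card ((\<lambda>a. bump a (first a)) ` pivots k (d - 1)) \<le> card ?L"
    using fin by (intro card_mono)
  then show ?thesis
    by (simp add: lambda_lex_hit_def lambda_lex_def card_image[OF inj_on_bump_first])
qed

theorem proposition4p8:
  fixes k d :: nat
  assumes "k \<ge> 1" and "d \<ge> 1"
  shows "(\<forall>t. Bt t k d = (if 2 ^ t dvd d then rho k (d div 2 ^ t - 1) else 0)) \<and>
    Max {Bt t k d | t. 2 ^ t \<le> d} = rho k (d - 1) \<and>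
    rho k (d - 1) \<le> lambda_lex_hit k d"
proof (intro conjI)
  show Bt: "\<forall>t. Bt t k d = (if 2 ^ t dvd d then rho k (d div 2 ^ t - 1) else 0)"
    using assms by (simp add: Bt_eq_card Bt_eq_0 rho_eq_card_pivots)
  \<comment> \<open>The maximum is attained at \<open>t = 0\<close>.\<close>
  have le: "Bt t k d \<le> rho k (d - 1)" for t
  proof (cases "t > 0 \<and> 2 ^ t dvd d")
    case True
    then have "even d" using dvd_trans[of 2 "2 ^ t" d] by (simp add: dvd_power)
    then have "odd (d - 1)" using assms by simp
    moreover have "d div 2 ^ t - 1 \<le> d - 1" by (simp add: diff_le_mono)
    ultimately show ?thesis
      using Bt True card_pivots_le_odd by (simp add: rho_eq_card_pivots)
  next
    case False
    then show ?thesis using Bt by (cases "t = 0") auto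
  qed
  have "finite {t::nat. 2 ^ t \<le> d}"
    by (rule finite_subset[of _ "{..d}"]) (auto intro: order.trans less_imp_le[OF less_exp])
  then show "Max {Bt t k d | t. 2 ^ t \<le> d} = rho k (d - 1)"
  proof (intro Max_eqI)
    show "rho k (d - 1) \<in> {Bt t k d | t. 2 ^ t \<le> d}"
      using Bt assms by (auto intro!: exI[of _ 0])
  qed (use le in auto)
  show "rho k (d - 1) \<le> lambda_lex_hit k d"
    using card_pivots_le_lambda_lex_hit assms by (simp add: rho_eq_card_pivots)
qed

end
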